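(* There are no automorphisms of $T$ which conjugate between $M_L^{(n)}$ and $M_B^{(n)}$.
   Context: $T$ is the rooted binary tree, whose $n$-th level set is the set of binary words $(c_1,\dots,c_n)\in\{0,1\}^n$; an automorphism of $T$ acts on each level set by a permutation, preserving the relation of being a prefix. The rows and columns of $2^n\times 2^n$ matrices are indexed by the $n$-th level set via $(c_1,\dots,c_n)\mapsto\sum_{j=1}^n c_j2^{n-j}\in\{0,\dots,2^n-1\}$. Conjugation by an automorphism $\theta$ of $T$ means conjugation by the permutation matrices $P_\theta^{(n)}$ of the permutations which $\theta$ induces on the level sets, i.e. $\left(P_\theta^{(n)}\right)^{-1}M_B^{(n)}P_\theta^{(n)}=M_L^{(n)}$. $\{M_L^{(n)}\}_{n=1,2,\dots}$ and $\{M_B^{(n)}\}_{n=1,2,\dots}$ are the families of transition operators of the lamplighter automaton and of the BBS translation (box-ball system with carrier capacity $1$), defined as follows. Lamplighter: real $2^n\times2^n$ matrices $a_{L,0}^{(n)},a_{L,1}^{(n)}$ with $a_{L,0}^{(0)}=a_{L,1}^{(0)}=1$ and $$a_{L,0}^{(n+1)}=\begin{pmatrix}0&a_{L,1}^{(n)}\\ a_{L,0}^{(n)}&0\end{pmatrix},\qquad a_{L,1}^{(n+1)}=\begin{pmatrix}a_{L,0}^{(n)}&0\\ 0&a_{L,1}^{(n)}\end{pmatrix}.$$ BBS translation: $a_{B,0}^{(0)}=a_{B,1}^{(0)}=1$ and $$a_{B,0}^{(n+1)}=\begin{pmatrix}a_{B,0}^{(n)}&a_{B,1}^{(n)}\\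 0&0\end{pmatrix},\qquad a_{B,1}^{(n+1)}=\begin{pmatrix}0&0\\ a_{B,0}^{(n)}&a_{B,1}^{(n)}\end{pmatrix}.$$ Then $M_L^{(n)}=\frac14\sum_{i=0}^1\left(a_{L,i}^{(n)}+a_{L,i}^{(n)*}\right)$ and $M_B^{(n)}=\frac14\sum_{i=0}^1\left(a_{B,i}^{(n)}+a_{B,i}^{(n)*}\right)$, where $*$ denotes the transpose. *)

theory Defs
  imports "HOL-Library.Sublist" "Jordan_Normal_Form.Determinant"
begin

section \<open>The rooted binary tree and its automorphisms\<close>

text \<open>The vertices of the tree are the finite binary words, with \<open>True\<close> for the digit 1.\<close>

definition level :: "nat \<Rightarrow> bool list set" where
  "level n = {w. length w = n}"

definition tree_automorphism :: "(bool list \<Rightarrow> bool list) \<Rightarrow> bool" where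
  "tree_automorphism \<theta> \<longleftrightarrow>
     (\<forall>n. bij_betw \<theta> (level n) (level n)) \<and>
     (\<forall>u v. prefix (\<theta> u) (\<theta> v) \<longleftrightarrow> prefix u v)"

text \<open>Lists are numbered from 0, so the letter \<open>c\<^sub>j\<close> of a word is \<open>w ! (j - 1)\<close>.\<close>

definition word_index :: "bool list \<Rightarrow> nat" where
  "word_index w = (\<Sum>j = 1..length w. of_bool (w ! (j - 1)) * 2 ^ (length w - j))"

text \<open>Column convention: the matrix sends the basis vector of \<open>w\<close> to that of \<open>\<theta> w\<close>.\<close>

definition perm_mat :: "(bool list \<Rightarrow> bool list) \<Rightarrow> nat \<Rightarrow> real mat" where
  "perm_mat \<theta> n = mat (2 ^ n) (2 ^ n)
     (\<lambda>(i, j). of_bool (\<exists>w \<in> level n. word_index w = j \<and> word_index (\<theta> w) = i))"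


section \<open>The transition operators\<close>

fun a_L0 :: "nat \<Rightarrow> real mat" and a_L1 :: "nat \<Rightarrow> real mat" where
  "a_L0 0 = 1\<^sub>m 1"
| "a_L1 0 = 1\<^sub>m 1"
| "a_L0 (Suc n) = four_block_mat (0\<^sub>m (2 ^ n) (2 ^ n)) (a_L1 n) (a_L0 n) (0\<^sub>m (2 ^ n) (2 ^ n))"
| "a_L1 (Suc n) = four_block_mat (a_L0 n) (0\<^sub>m (2 ^ n) (2 ^ n)) (0\<^sub>m (2 ^ n) (2 ^ n)) (a_L1 n)"

fun a_B0 :: "nat \<Rightarrow> real mat" and a_B1 :: "nat \<Rightarrow> real mat" where
  "a_B0 0 = 1\<^sub>m 1"
| "a_B1 0 = 1\<^sub>m 1"
| "a_B0 (Suc n) = four_block_mat (a_B0 n) (a_B1 n) (0\<^sub>m (2 ^ n) (2 ^ n)) (0\<^sub>m (2 ^ n) (2 ^ n))"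
| "a_B1 (Suc n) = four_block_mat (0\<^sub>m (2 ^ n) (2 ^ n)) (0\<^sub>m (2 ^ n) (2 ^ n)) (a_B0 n) (a_B1 n)"

definition M_L :: "nat \<Rightarrow> real mat" where
  "M_L n = (1 / 4) \<cdot>\<^sub>m ((a_L0 n + transpose_mat (a_L0 n)) + (a_L1 n + transpose_mat (a_L1 n)))"

definition M_B :: "nat \<Rightarrow> real mat" where
  "M_B n = (1 / 4) \<cdot>\<^sub>m ((a_B0 n + transpose_mat (a_B0 n)) + (a_B1 n + transpose_mat (a_B1 n)))"


section \<open>Well-definedness of the indexing and of the inverse permutation matrix\<close>

lemma word_index_Nil [simp]: "word_index [] = 0"
  by (simp add: word_index_def)

lemma word_index_Cons:
  "word_index (c # w) = of_bool c * 2 ^ length w + word_index w"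
proof -
  have alt: "word_index v = (\<Sum>j<length v. of_bool (v ! j) * 2 ^ (length v - Suc j))" for v
    unfolding word_index_def
    by (rule sum.reindex_bij_witness[of _ Suc "\<lambda>j. j - 1"]) auto
  show ?thesis
    unfolding alt by (simp only: list.size(4) add_Suc_right add_0_right sum.lessThan_Suc_shift) simp
qed

lemma word_index_less: "word_index w < 2 ^ length w"
  by (induction w) (auto simp: word_index_Cons)

lemma word_index_inj:
  "length v = length w \<Longrightarrow> word_index v = word_index w \<Longrightarrow> v = w"
proof (induction v w rule: list_induct2)
  case (Cons x xs y ys)
  then show ?case
    using word_index_less[of xs] word_index_less[of ys]
    by (cases x; cases y) (simp_all add: word_index_Cons)
qed simp

lemma bij_betw_word_index: "bij_betw word_index (level n) {..<2 ^ n}"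
proof -
  have inj: "inj_on word_index (level n)"
    by (auto simp: inj_on_def level_def intro: word_index_inj)
  have sub: "word_index ` level n \<subseteq> {..<2 ^ n}"
    using word_index_less by (auto simp: level_def)
  have "card (level n) = 2 ^ n"
    using card_lists_length_eq[of "UNIV :: bool set" n] by (simp add: level_def card_UNIV_bool)
  then have "word_index ` level n = {..<2 ^ n}"
    using inj sub by (intro card_subset_eq) (auto simp: card_image)
  then show ?thesis
    using inj by (simp add: bij_betw_def)
qed

lemma perm_mat_transpose:
  assumes "tree_automorphism \<theta>"
  shows "transpose_mat (perm_mat \<theta> n) * perm_mat \<theta> n = 1\<^sub>m (2 ^ n)"
proof (rule eq_matI)
  fix i j :: nat
  assume "i < dim_row (1\<^sub>m (2 ^ n) :: real mat)" and "j < dim_col (1\<^sub>m (2 ^ n) :: real mat)"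
  then have ij: "i < 2 ^ n" "j < 2 ^ n" by auto
  obtain u where u: "u \<in> level n" "word_index u = i"
    using bij_betw_imp_surj_on[OF bij_betw_word_index[of n]] ij by (metis imageE lessThan_iff)
  obtain v where v: "v \<in> level n" "word_index v = j"
    using bij_betw_imp_surj_on[OF bij_betw_word_index[of n]] ij by (metis imageE lessThan_iff)
  have th: "bij_betw \<theta> (level n) (level n)"
    using assms by (simp add: tree_automorphism_def)
  have inj: "word_index x = word_index y \<longleftrightarrow> x = y" if "x \<in> level n" "y \<in> level n" for x y
    using that word_index_inj by (auto simp: level_def)
  have tl: "\<theta> x \<in> level n" if "x \<in> level n" for x
    using th that by (auto simp: bij_betw_def)
  have ent: "perm_mat \<theta> n $$ (k, word_index x) = of_bool (k = word_index (\<theta> x))"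
    if "x \<in> level n" "k < 2 ^ n" for x k
    using that word_index_less[of x] inj by (auto simp: perm_mat_def level_def)
  have "(transpose_mat (perm_mat \<theta> n) * perm_mat \<theta> n) $$ (i, j)
      = (\<Sum>k = 0..<2 ^ n. perm_mat \<theta> n $$ (k, i) * perm_mat \<theta> n $$ (k, j))"
    using ij by (simp add: scalar_prod_def perm_mat_def)
  also have "\<dots> = (\<Sum>k = 0..<2 ^ n. if k = word_index (\<theta> u)
                       then of_bool (word_index (\<theta> u) = word_index (\<theta> v)) else 0)"
    using ent u v by (intro sum.cong) auto
  also have "\<dots> = of_bool (word_index (\<theta> u) = word_index (\<theta> v))"
    using word_index_less[of "\<theta> u"] tl[OF u(1)] by (simp add: level_def)
  also have "\<dots> = of_bool (u = v)"
    using inj tl u v th by (auto simp: bij_betw_def inj_on_def)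
  also have "\<dots> = 1\<^sub>m (2 ^ n) $$ (i, j)"
    using u v ij inj by auto
  finally show "(transpose_mat (perm_mat \<theta> n) * perm_mat \<theta> n) $$ (i, j) = 1\<^sub>m (2 ^ n) $$ (i, j)" .
qed (auto simp: perm_mat_def)

lemma mat_inverse_perm_mat:
  assumes "tree_automorphism \<theta>"
  shows "mat_inverse (perm_mat \<theta> n) = Some (transpose_mat (perm_mat \<theta> n))"
proof -
  let ?P = "perm_mat \<theta> n"
  have P: "?P \<in> carrier_mat (2 ^ n) (2 ^ n)" by (simp add: perm_mat_def)
  then have Q: "transpose_mat ?P \<in> carrier_mat (2 ^ n) (2 ^ n)" by simp
  note QP = perm_mat_transpose[OF assms, of n]
  have PQ: "?P * transpose_mat ?P = 1\<^sub>m (2 ^ n)"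
    using mat_mult_left_right_inverse[OF Q P QP] .
  have U: "?P \<in> Units (ring_mat TYPE(real) (2 ^ n) ())"
    using P Q PQ QP by (auto simp: Units_def ring_mat_def)
  then obtain B where B: "mat_inverse ?P = Some B"
    using mat_inverse(1)[OF P, where b = "()"] by (cases "mat_inverse ?P") auto
  have BP: "B * ?P = 1\<^sub>m (2 ^ n)" and Bc: "B \<in> carrier_mat (2 ^ n) (2 ^ n)"
    using mat_inverse(2)[OF P B] by auto
  have "B = B * (?P * transpose_mat ?P)" using PQ Bc by simp
  also have "\<dots> = (B * ?P) * transpose_mat ?P" using assoc_mult_mat[OF Bc P Q] by simp
  also have "\<dots> = transpose_mat ?P" using BP Q by simp
  finally show ?thesis using B by simp
qed

end

theory Submission imports Defs begin

text \<open>
  The obstruction already appears on the second level of the tree, in the diagonals of the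
  transition operators. Conjugation by the permutation matrix of \<open>\<theta>\<close> moves the diagonal entry at
  \<open>\<theta> w\<close> to the position \<open>w\<close> (\<open>perm_mat_conjugate_entry\<close>). The diagonal of \<open>M_L 2\<close> is
  \<open>(0, 0, 1/2, 1/2)\<close>, so its nonzero entries sit at the words \<open>10\<close> and \<open>11\<close>, which are siblings;
  the diagonal of \<open>M_B 2\<close> is \<open>(1/2, 0, 0, 1/2)\<close>, with nonzero entries at \<open>00\<close> and \<open>11\<close>, which have
  different parents. A conjugating \<open>\<theta>\<close> would have to map the first pair of words onto the second,
  but an automorphism of the tree maps siblings to siblings.
\<close>

lemma tree_automorphism_length:
  assumes "tree_automorphism \<theta>"
  shows "length (\<theta> w) = length w"
proof -
  have "bij_betw \<theta> (level (length w)) (level (length w))"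
    using assms by (simp add: tree_automorphism_def)
  then have "\<theta> w \<in> level (length w)"
    by (rule bij_betw_apply) (simp add: level_def)
  then show ?thesis
    by (simp add: level_def)
qed

lemma tree_automorphism_inj:
  assumes "tree_automorphism \<theta>" and "\<theta> u = \<theta> v"
  shows "u = v"
  using assms by (metis prefix_order.antisym prefix_order.refl tree_automorphism_def)

lemma perm_mat_col:
  assumes "length w = n"
  shows "col (perm_mat \<theta> n) (word_index w) =
    vec (2 ^ n) (\<lambda>i. of_bool (i = word_index (\<theta> w)))"
proof -
  have "(\<exists>v\<in>level n. word_index v = word_index w \<and> word_index (\<theta> v) = i) \<longleftrightarrow>
      i = word_index (\<theta> w)" for i
    using assms by (auto simp: level_def dest: word_index_inj)
  then show ?thesis
    using word_index_less[of w] assms by (auto simp: perm_mat_def)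
qed

text \<open>
  Since the inverse of a permutation matrix is its transpose, the conjugated entry is the bilinear
  form of \<open>M\<close> evaluated at two columns of the permutation matrix.
\<close>

lemma perm_mat_conjugate_entry:
  assumes \<theta>: "tree_automorphism \<theta>" and M: "M \<in> carrier_mat (2 ^ n) (2 ^ n)"
    and u: "length u = n" and v: "length v = n"
  shows "(the (mat_inverse (perm_mat \<theta> n)) * M * perm_mat \<theta> n) $$ (word_index u, word_index v) =
    M $$ (word_index (\<theta> u), word_index (\<theta> v))"
proof -
  let ?P = "perm_mat \<theta> n"
  have P: "?P \<in> carrier_mat (2 ^ n) (2 ^ n)"
    by (simp add: perm_mat_def)
  have iu: "word_index u < 2 ^ n" and iv: "word_index v < 2 ^ n"
    and tu: "word_index (\<theta> u) < 2 ^ n" and tv: "word_index (\<theta> v) < 2 ^ n"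
    using word_index_less[of u] word_index_less[of v] word_index_less[of "\<theta> u"]
      word_index_less[of "\<theta> v"] tree_automorphism_length[OF \<theta>] u v by auto
  have unit: "vec (2 ^ n) (\<lambda>i. of_bool (i = k)) = (unit_vec (2 ^ n) k :: real vec)" for k
    by (auto simp: unit_vec_def)
  have "the (mat_inverse ?P) * M * ?P = transpose_mat ?P * (M * ?P)"
    using P M by (simp add: mat_inverse_perm_mat[OF \<theta>])
  also have "\<dots> $$ (word_index u, word_index v) =
      col ?P (word_index u) \<bullet> (M *\<^sub>v col ?P (word_index v))"
    using P M iu iv by (simp add: col_mult2[OF M P])
  also have "\<dots> = M $$ (word_index (\<theta> u), word_index (\<theta> v))"
    using M tu tv by (simp add: perm_mat_col u v unit)
  finally show ?thesis .
qed

lemma a_B_carrier: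
  "a_B0 n \<in> carrier_mat (2 ^ n) (2 ^ n)" "a_B1 n \<in> carrier_mat (2 ^ n) (2 ^ n)"
  by (induction n) auto

lemma M_B_carrier: "M_B n \<in> carrier_mat (2 ^ n) (2 ^ n)"
  using a_B_carrier[of n] by (simp add: M_B_def)

lemma M_L_2_diagonal: "M_L 2 $$ (2, 2) = 1 / 2" "M_L 2 $$ (3, 3) = 1 / 2"
  by (simp_all add: M_L_def numeral_2_eq_2 numeral_3_eq_3)

lemma M_B_2_diagonal: "M_B 2 $$ (1, 1) = 0" "M_B 2 $$ (2, 2) = 0"
  by (simp_all add: M_B_def numeral_2_eq_2)

text \<open>The image of the common parent is a common prefix of the images of two siblings.\<close>

lemma tree_automorphism_siblings:
  assumes \<theta>: "tree_automorphism \<theta>"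
  shows "butlast (\<theta> (w @ [a])) = butlast (\<theta> (w @ [b]))"
proof -
  have "butlast (\<theta> (w @ [c])) = \<theta> w" for c
  proof -
    have "prefix (\<theta> w) (\<theta> (w @ [c]))"
      using \<theta> by (simp add: tree_automorphism_def)
    then obtain s where s: "\<theta> (w @ [c]) = \<theta> w @ s"
      by (auto simp: prefix_def)
    then have "length s = 1"
      using tree_automorphism_length[OF \<theta>, of "w @ [c]"] tree_automorphism_length[OF \<theta>, of w]
      by simp
    then show ?thesis
      by (auto simp: s length_Suc_conv butlast_append)
  qed
  then show ?thesis
    by simp
qed

theorem proposition5p5:
  "\<not> (\<exists>\<theta>. tree_automorphism \<theta> \<and>
        (\<forall>n\<ge>1. the (mat_inverse (perm_mat \<theta> n)) * M_B n * perm_mat \<theta> n = M_L n))"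
proof
  assume "\<exists>\<theta>. tree_automorphism \<theta> \<and>
      (\<forall>n\<ge>1. the (mat_inverse (perm_mat \<theta> n)) * M_B n * perm_mat \<theta> n = M_L n)"
  then obtain \<theta> where \<theta>: "tree_automorphism \<theta>"
    and conj: "the (mat_inverse (perm_mat \<theta> 2)) * M_B 2 * perm_mat \<theta> 2 = M_L 2"
    by fastforce
  have image: "\<theta> [True, c] = [False, False] \<or> \<theta> [True, c] = [True, True]" for c
  proof -
    have "M_B 2 $$ (word_index (\<theta> [True, c]), word_index (\<theta> [True, c])) =
        M_L 2 $$ (word_index [True, c], word_index [True, c])"
      using perm_mat_conjugate_entry[OF \<theta> M_B_carrier, of "[True, c]" 2 "[True, c]"]
      by (simp add: conj)
    also have "\<dots> = 1 / 2"
      using M_L_2_diagonal by (cases c) (simp_all add: word_index_Cons)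
    finally have nonzero: "M_B 2 $$ (word_index (\<theta> [True, c]), word_index (\<theta> [True, c])) \<noteq> 0"
      by simp
    obtain x y where xy: "\<theta> [True, c] = [x, y]"
      using tree_automorphism_length[OF \<theta>, of "[True, c]"] by (auto simp: length_Suc_conv)
    show ?thesis
      using nonzero M_B_2_diagonal unfolding xy
      by (cases x; cases y) (simp_all add: word_index_Cons)
  qed
  have "butlast (\<theta> [True, False]) = butlast (\<theta> [True, True])"
    using tree_automorphism_siblings[OF \<theta>, of "[True]" False True] by simp
  \<comment> \<open>The words \<open>00\<close> and \<open>11\<close> differ in their first letter, so both siblings have the same image.\<close>
  then have "\<theta> [True, False] = \<theta> [True, True]"
    using image[of False] image[of True] by auto
  then show False
    using tree_automorphism_inj[OF \<theta>] by blast
qed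

end
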